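(* Let $V\subseteq\mathbf R^d$ be a vector space. Then the following inclusions are true: $$\mathscr P(\mathbf R^d)\subseteq\mathscr P_E(\mathbf R^d)\subseteq\mathscr P_D^0(\mathbf R^d)\cap\mathscr P_G^0(\mathbf R^d),\qquad\mathscr P_D^0(\mathbf R^d)\subseteq\mathscr P_{D,V}^0(\mathbf R^d)\subseteq\mathscr P_D(\mathbf R^d),$$ $$\mathscr P_G^0(\mathbf R^d)\subseteq\mathscr P_Q^0(\mathbf R^d)\cap\mathscr P_G(\mathbf R^d)\subseteq\mathscr P_Q^0(\mathbf R^d)\cup\mathscr P_G(\mathbf R^d)\subseteq\mathscr P_Q(\mathbf R^d).$$ Furthermore, if $C>0$, $0\le\gamma<2$, $t\in\mathbf R$ and $\omega(x)=Ce^{t|x|^\gamma}$, $x\in\mathbf R^d$, then $\omega\in\mathscr P_D^0(\mathbf R^d)\cap\mathscr P_G^0(\mathbf R^d)$.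
   Context: A weight on $\mathbf R^d$ is a positive function $\omega\in L^\infty_{loc}(\mathbf R^d)$ bounded below by a positive constant on each compact set. $\omega$ is $v$-moderate, for positive $v\in L^\infty_{loc}(\mathbf R^d)$, if $\omega(x+y)\le C\omega(x)v(y)$ for all $x,y$ and some $C>0$. $\mathscr P(\mathbf R^d)$ (resp. $\mathscr P_E(\mathbf R^d)$) is the set of weights that are $v$-moderate for some polynomial $v$ (resp. for some $v(x)=Ce^{c|x|}$, $c,C>0$). Consider the conditions: (L) there are $c,C>0$ with $C^{-1}\omega(x)\le\omega(x+y)\le C\omega(x)$ whenever $|x|\ge2c$, $|y|\le c/|x|$; (L$'$) there are $c,C>0$ with $C^{-1}\omega(x)^2\le\omega(x+y)\omega(x-y)\le C\omega(x)^2$ whenever $|x|\ge2c$, $|y|\le c/|x|$; (E) $C^{-1}e^{-c|x|^2}\le\omega(x)\le Ce^{c|x|^2}$ for all $x$. $\mathscr P_G(\mathbf R^d)$ (resp. $\mathscr P_Q(\mathbf R^d)$) is the set of weights satisfying (L) (resp. (L$'$)) and (E) for some $c,C>0$. $\mathscr P_G^0(\mathbf R^d)$ (resp. $\mathscr P_Q^0(\mathbf R^d)$) is the set of weights satisfying (L) (resp. (L$'$)) and such that for every $c>0$ there is $C>0$ with (E). Let $V\subseteq\mathbf R^d$ be a vector space and $\varepsilon\in(0,1]$. $\omega\in\mathscr P_Q^0(\mathbf R^d)$ is dilated suitable with respect to $\varepsilon$ if there are $C_\varepsilon>0$, $\theta_\varepsilon\in(0,1)$ with $$\frac{\omega(2^{1/2}x)e^{-\varepsilon(1-\lambda^2)|x|^2/2}}{\omega(2^{1/2}\lambda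 x)}\le C_\varepsilon,\qquad1-\theta_\varepsilon<\lambda<1,\ x\in\mathbf R^d.$$ $\omega\in\mathscr P_Q^0(\mathbf R^d)$ is narrowly dilated suitable with respect to $\varepsilon$ and $V$ if it is dilated suitable with respect to $\varepsilon$ and, for some continuous weight $\omega_0$ equivalent to $\omega$ (i.e. $C^{-1}\omega_0\le\omega\le C\omega_0$ for some $C>0$) and every $x_1\in V$, $$\lim_{\lambda\to1-}\Big(\sup_{x_2\in V^\perp}\frac{\omega_0(2^{1/2}x)e^{-\varepsilon(1-\lambda^2)|x|^2/2}}{\omega_0(2^{1/2}\lambda x)}\Big)\le1,\qquad x=x_1+x_2.$$ $\mathscr P_D(\mathbf R^d)$ is the set of $\omega\in\mathscr P_Q^0(\mathbf R^d)$ such that both $\omega$ and $1/\omega$ are dilated suitable with respect to every $\varepsilon\in(0,1]$. $\mathscr P_{D,V}^0(\mathbf R^d)$ is the set of $\omega\in\mathscr P_Q^0(\mathbf R^d)$ such that both $\omega$ and $1/\omega$ are narrowly dilated suitable with respect to $V$ and every $\varepsilon\in(0,1]$. $\mathscr P_D^0(\mathbf R^d)=\mathscr P_{D,\{0\}}^0(\mathbf R^d)$. *)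

theory Defs
  imports "HOL-Analysis.Analysis"
begin

text \<open>
  Weights are honest functions, not classes modulo null sets, since all conditions on them
  are imposed at every point. Membership in \<open>L\<^sup>\<infinity>\<^sub>l\<^sub>o\<^sub>c\<close> means Lebesgue
  measurable and essentially bounded on every compact set.
\<close>

definition Linf_loc :: "('a::euclidean_space \<Rightarrow> real) \<Rightarrow> bool" where
  "Linf_loc f \<longleftrightarrow> f \<in> borel_measurable lebesgue \<and>
     (\<forall>K. compact K \<longrightarrow> (\<exists>B. AE x in lebesgue. x \<in> K \<longrightarrow> \<bar>f x\<bar> \<le> B))"

definition weight :: "('a::euclidean_space \<Rightarrow> real) \<Rightarrow> bool" where
  "weight \<omega> \<longleftrightarrow> (\<forall>x. \<omega> x > 0) \<and> Linf_loc \<omega> \<and>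
     (\<forall>K. compact K \<longrightarrow> (\<exists>b>0. \<forall>x\<in>K. b \<le> \<omega> x))"

definition moderate :: "('a::euclidean_space \<Rightarrow> real) \<Rightarrow> ('a \<Rightarrow> real) \<Rightarrow> bool" where
  "moderate v \<omega> \<longleftrightarrow> (\<forall>x. v x > 0) \<and> Linf_loc v \<and>
     (\<exists>C>0. \<forall>x y. \<omega> (x + y) \<le> C * \<omega> x * v y)"

definition P_poly :: "('a::euclidean_space \<Rightarrow> real) set" where
  "P_poly = {\<omega>. weight \<omega> \<and> (\<exists>v. real_polynomial_function v \<and> moderate v \<omega>)}"

definition P_E :: "('a::euclidean_space \<Rightarrow> real) set" where
  "P_E = {\<omega>. weight \<omega> \<and> (\<exists>c>0. \<exists>C>0. moderate (\<lambda>x. C * exp (c * norm x)) \<omega>)}"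

definition cond_L :: "('a::euclidean_space \<Rightarrow> real) \<Rightarrow> bool" where
  "cond_L \<omega> \<longleftrightarrow> (\<exists>c>0. \<exists>C>0. \<forall>x y. norm x \<ge> 2 * c \<longrightarrow> norm y \<le> c / norm x \<longrightarrow>
     inverse C * \<omega> x \<le> \<omega> (x + y) \<and> \<omega> (x + y) \<le> C * \<omega> x)"

definition cond_L' :: "('a::euclidean_space \<Rightarrow> real) \<Rightarrow> bool" where
  "cond_L' \<omega> \<longleftrightarrow> (\<exists>c>0. \<exists>C>0. \<forall>x y. norm x \<ge> 2 * c \<longrightarrow> norm y \<le> c / norm x \<longrightarrow>
     inverse C * (\<omega> x)\<^sup>2 \<le> \<omega> (x + y) * \<omega> (x - y) \<and>
     \<omega> (x + y) * \<omega> (x - y) \<le> C * (\<omega> x)\<^sup>2)"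

definition cond_E :: "real \<Rightarrow> real \<Rightarrow> ('a::euclidean_space \<Rightarrow> real) \<Rightarrow> bool" where
  "cond_E c C \<omega> \<longleftrightarrow>
     (\<forall>x. inverse C * exp (- c * (norm x)\<^sup>2) \<le> \<omega> x \<and> \<omega> x \<le> C * exp (c * (norm x)\<^sup>2))"

definition P_G :: "('a::euclidean_space \<Rightarrow> real) set" where
  "P_G = {\<omega>. weight \<omega> \<and> cond_L \<omega> \<and> (\<exists>c>0. \<exists>C>0. cond_E c C \<omega>)}"

definition P_Q :: "('a::euclidean_space \<Rightarrow> real) set" where
  "P_Q = {\<omega>. weight \<omega> \<and> cond_L' \<omega> \<and> (\<exists>c>0. \<exists>C>0. cond_E c C \<omega>)}"

definition P_G0 :: "('a::euclidean_space \<Rightarrow> real) set" where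
  "P_G0 = {\<omega>. weight \<omega> \<and> cond_L \<omega> \<and> (\<forall>c>0. \<exists>C>0. cond_E c C \<omega>)}"

definition P_Q0 :: "('a::euclidean_space \<Rightarrow> real) set" where
  "P_Q0 = {\<omega>. weight \<omega> \<and> cond_L' \<omega> \<and> (\<forall>c>0. \<exists>C>0. cond_E c C \<omega>)}"

definition equivalent_weights :: "('a::euclidean_space \<Rightarrow> real) \<Rightarrow> ('a \<Rightarrow> real) \<Rightarrow> bool" where
  "equivalent_weights \<omega> \<omega>0 \<longleftrightarrow> (\<exists>C>0. \<forall>x. inverse C * \<omega>0 x \<le> \<omega> x \<and> \<omega> x \<le> C * \<omega>0 x)"

definition dilation_quotient :: "real \<Rightarrow> ('a::euclidean_space \<Rightarrow> real) \<Rightarrow> real \<Rightarrow> 'a \<Rightarrow> real" where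
  "dilation_quotient \<epsilon> \<omega> l x =
     \<omega> (sqrt 2 *\<^sub>R x) * exp (- \<epsilon> * (1 - l\<^sup>2) * (norm x)\<^sup>2 / 2) / \<omega> ((sqrt 2 * l) *\<^sub>R x)"

definition dilated_suitable :: "real \<Rightarrow> ('a::euclidean_space \<Rightarrow> real) \<Rightarrow> bool" where
  "dilated_suitable \<epsilon> \<omega> \<longleftrightarrow> \<omega> \<in> P_Q0 \<and>
     (\<exists>C>0. \<exists>\<theta>. 0 < \<theta> \<and> \<theta> < 1 \<and>
        (\<forall>l x. 1 - \<theta> < l \<longrightarrow> l < 1 \<longrightarrow> dilation_quotient \<epsilon> \<omega> l x \<le> C))"

text \<open>
  The supremum is taken in the extended reals, so that it is meaningful without a prior
  bound, and the limit as \<open>l\<close> tends to \<open>1\<close> from the left is required to exist.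
\<close>

definition narrowly_dilated_suitable ::
    "real \<Rightarrow> 'a set \<Rightarrow> ('a::euclidean_space \<Rightarrow> real) \<Rightarrow> bool" where
  "narrowly_dilated_suitable \<epsilon> V \<omega> \<longleftrightarrow> dilated_suitable \<epsilon> \<omega> \<and>
     (\<exists>\<omega>0. weight \<omega>0 \<and> continuous_on UNIV \<omega>0 \<and> equivalent_weights \<omega> \<omega>0 \<and>
        (\<forall>x1\<in>V. \<exists>L\<le>1.
           ((\<lambda>l. SUP x2\<in>orthogonal_comp V. ereal (dilation_quotient \<epsilon> \<omega>0 l (x1 + x2))) \<longlongrightarrow> L)
             (at_left 1)))"

definition P_D :: "('a::euclidean_space \<Rightarrow> real) set" where
  "P_D = {\<omega>. \<omega> \<in> P_Q0 \<and> (\<forall>\<epsilon>. 0 < \<epsilon> \<longrightarrow> \<epsilon> \<le> 1 \<longrightarrow>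
     dilated_suitable \<epsilon> \<omega> \<and> dilated_suitable \<epsilon> (\<lambda>x. 1 / \<omega> x))}"

definition P_DV0 :: "'a set \<Rightarrow> ('a::euclidean_space \<Rightarrow> real) set" where
  "P_DV0 V = {\<omega>. \<omega> \<in> P_Q0 \<and> (\<forall>\<epsilon>. 0 < \<epsilon> \<longrightarrow> \<epsilon> \<le> 1 \<longrightarrow>
     narrowly_dilated_suitable \<epsilon> V \<omega> \<and> narrowly_dilated_suitable \<epsilon> V (\<lambda>x. 1 / \<omega> x))}"

definition P_D0 :: "('a::euclidean_space \<Rightarrow> real) set" where
  "P_D0 = P_DV0 {0}"

text \<open>
  The power \<open>|x|\<^sup>\<gamma>\<close> with the convention \<open>0\<^sup>0 = 1\<close>, in contrast to
  \<open>0 powr 0 = 0\<close>.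
\<close>

definition norm_pow :: "'a::real_normed_vector \<Rightarrow> real \<Rightarrow> real" where
  "norm_pow x \<gamma> = (if \<gamma> = 0 then 1 else norm x powr \<gamma>)"

end

theory Submission
  imports Defs
begin

text \<open>
  The inclusions between the classes without a dilation condition are direct: polynomials grow
  at most exponentially, a function that is moderate with respect to \<open>C exp (c |x|)\<close> varies by a
  bounded factor under bounded translations and grows subquadratically on the logarithmic scale,
  and multiplying the two-sided bounds of \<open>cond_L\<close> for \<open>y\<close> and \<open>- y\<close> gives \<open>cond_L'\<close>.

  Dilations are handled by one quantitative property of a continuous weight \<open>\<omega>0\<close>: along each
  ray, the increase of \<open>ln \<omega>0\<close> from \<open>l x\<close> to \<open>x\<close> is at most \<open>(1 - l\<^sup>2) (\<delta> |x|\<^sup>2 + K)\<close>, where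
  \<open>\<delta>\<close> is as small as desired (\<open>radially_tame\<close>). The Gaussian factor of the dilation quotient
  absorbs the quadratic term and leaves the bound \<open>exp (K (1 - l\<^sup>2))\<close>, uniformly in \<open>x\<close>. It tends
  to \<open>1\<close>, while the quotient at the origin is always \<open>1\<close>; hence the limit in the narrow condition
  exists and equals \<open>1\<close> (\<open>radially_tame_imp_narrowly_dilated_suitable\<close>).

  There are two sources of tame weights. For a moderate weight \<open>\<omega>\<close>, the regularisation
  \<open>sup\<^sub>z \<omega> z exp (- c |x - z|)\<close> is equivalent to \<open>\<omega>\<close>, and its logarithm is \<open>c\<close>-Lipschitz, so no
  multiplicative constant is lost as \<open>l\<close> tends to \<open>1\<close>. For \<open>C exp (t |x|\<^sup>\<gamma>)\<close> with
  \<open>\<gamma> < 2\<close>, homogeneity gives the factor \<open>1 - l\<^sup>\<gamma> \<le> 1 - l\<^sup>2\<close>. Both families are closed under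
  taking reciprocals, which deals with \<open>1 / \<omega>\<close>.

  Finally, enlarging \<open>V\<close> from \<open>{0}\<close> shrinks the set over which the supremum is taken,
  while continuity of \<open>\<omega>0\<close> at the fixed point \<open>x1\<close> keeps the supremum from dropping below \<open>1\<close> in
  the limit. Thus the supremum is squeezed and the same \<open>\<omega>0\<close> serves for every \<open>V\<close>.
\<close>

section \<open>Weights and the translation conditions\<close>

lemma continuous_imp_Linf_loc:
  fixes f :: "'a::euclidean_space \<Rightarrow> real"
  assumes "continuous_on UNIV f"
  shows "Linf_loc f"
  unfolding Linf_loc_def
proof (intro conjI allI impI)
  show "f \<in> borel_measurable lebesgue"
    using borel_measurable_continuous_onI[OF assms] by (simp add: measurable_completion)
  fix K :: "'a set"
  assume "compact K"
  then have "bounded (f ` K)"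
    by (intro compact_imp_bounded compact_continuous_image continuous_on_subset[OF assms]) auto
  then obtain B where "\<forall>x\<in>K. \<bar>f x\<bar> \<le> B"
    by (auto simp: bounded_iff)
  then show "\<exists>B. AE x in lebesgue. x \<in> K \<longrightarrow> \<bar>f x\<bar> \<le> B"
    by (intro exI[of _ B]) auto
qed

lemma continuous_pos_imp_weight:
  fixes f :: "'a::euclidean_space \<Rightarrow> real"
  assumes cont: "continuous_on UNIV f" and pos: "\<And>x. f x > 0"
  shows "weight f"
  unfolding weight_def
proof (intro conjI allI impI)
  show "Linf_loc f"
    using cont by (rule continuous_imp_Linf_loc)
  fix K :: "'a set"
  assume K: "compact K"
  show "\<exists>b>0. \<forall>x\<in>K. b \<le> f x"
  proof (cases "K = {}")
    case False
    then obtain z where "z \<in> K" "\<forall>x\<in>K. f z \<le> f x"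
      using continuous_attains_inf[OF K False continuous_on_subset[OF cont]] by auto
    then show ?thesis
      using pos by blast
  qed (auto intro: exI[of _ 1])
qed (rule pos)

lemma cond_L_imp_cond_L':
  fixes \<omega> :: "'a::euclidean_space \<Rightarrow> real"
  assumes L: "cond_L \<omega>" and pos: "\<And>x. \<omega> x > 0"
  shows "cond_L' \<omega>"
proof -
  obtain c C where c: "c > 0" "C > 0" and
    b: "\<And>x y. norm x \<ge> 2 * c \<Longrightarrow> norm y \<le> c / norm x \<Longrightarrow>
      inverse C * \<omega> x \<le> \<omega> (x + y) \<and> \<omega> (x + y) \<le> C * \<omega> x"
    using L unfolding cond_L_def by blast
  have "inverse (C\<^sup>2) * (\<omega> x)\<^sup>2 \<le> \<omega> (x + y) * \<omega> (x - y) \<and>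
      \<omega> (x + y) * \<omega> (x - y) \<le> C\<^sup>2 * (\<omega> x)\<^sup>2"
    if h: "norm x \<ge> 2 * c" "norm y \<le> c / norm x" for x y
  proof -
    have p: "inverse C * \<omega> x \<le> \<omega> (x + y)" "\<omega> (x + y) \<le> C * \<omega> x"
      using b[OF h] by auto
    have m: "inverse C * \<omega> x \<le> \<omega> (x - y)" "\<omega> (x - y) \<le> C * \<omega> x"
      using b[of x "- y"] h by auto
    have nn: "0 \<le> inverse C * \<omega> x" "0 \<le> C * \<omega> x" "0 \<le> \<omega> (x + y)" "0 \<le> \<omega> (x - y)"
      using c pos[of x] pos[of "x + y"] pos[of "x - y"] by auto
    show ?thesis
      using mult_mono[OF p(1) m(1) nn(3) nn(1)] mult_mono[OF p(2) m(2) nn(2) nn(4)]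
      by (simp add: power2_eq_square algebra_simps)
  qed
  then show ?thesis
    unfolding cond_L'_def using c by (intro exI[of _ c] exI[of _ "C\<^sup>2"] conjI) auto
qed

lemma P_G0_subset_P_Q0: "P_G0 \<subseteq> P_Q0"
  by (auto simp: P_G0_def P_Q0_def weight_def cond_L_imp_cond_L')

lemma P_G_subset_P_Q: "P_G \<subseteq> P_Q"
  by (auto simp: P_G_def P_Q_def weight_def cond_L_imp_cond_L')

lemma P_G0_subset_P_G: "P_G0 \<subseteq> P_G"
  unfolding P_G0_def P_G_def using zero_less_one by blast

lemma P_Q0_subset_P_Q: "P_Q0 \<subseteq> P_Q"
  unfolding P_Q0_def P_Q_def using zero_less_one by blast

section \<open>Moderate weights\<close>

lemma real_polynomial_function_exp_bound:
  fixes v :: "'a::euclidean_space \<Rightarrow> real"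
  assumes "real_polynomial_function v"
  shows "\<exists>c>0. \<exists>C>0. \<forall>x. \<bar>v x\<bar> \<le> C * exp (c * norm x)"
  using assms
proof (induction rule: real_polynomial_function.induct)
  case (linear f)
  then obtain K where K: "K > 0" "\<And>x. norm (f x) \<le> norm x * K"
    using bounded_linear.pos_bounded by blast
  have "\<bar>f x\<bar> \<le> K * exp (1 * norm x)" for x
  proof -
    have "norm x \<le> exp (norm x)"
      using exp_ge_add_one_self[of "norm x"] by linarith
    then show ?thesis
      using order_trans[OF K(2)[of x], of "exp (norm x) * K"] K(1)
      by (simp add: mult.commute)
  qed
  then show ?case
    using K(1) zero_less_one by blast
next
  case (const k)
  have "\<bar>k\<bar> \<le> (\<bar>k\<bar> + 1) * exp (1 * norm x)" for x :: 'a
    using mult_mono[of "\<bar>k\<bar>" "\<bar>k\<bar> + 1" 1 "exp (norm x)"] by simp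
  then show ?case
    by (intro exI[of _ 1] exI[of _ "\<bar>k\<bar> + 1"] conjI) auto
next
  case (add f g)
  then obtain c C d D where cd: "c > 0" "C > 0" "d > 0" "D > 0"
    and f: "\<And>x. \<bar>f x\<bar> \<le> C * exp (c * norm x)" and g: "\<And>x. \<bar>g x\<bar> \<le> D * exp (d * norm x)"
    by blast
  have "\<bar>f x + g x\<bar> \<le> (C + D) * exp ((c + d) * norm x)" for x
  proof -
    have "C * exp (c * norm x) \<le> C * exp ((c + d) * norm x)"
      "D * exp (d * norm x) \<le> D * exp ((c + d) * norm x)"
      using cd by (simp_all add: algebra_simps)
    then show ?thesis
      using f[of x] g[of x] by (simp add: algebra_simps)
  qed
  then show ?case
    using cd by (intro exI[of _ "c + d"] exI[of _ "C + D"] conjI) auto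
next
  case (mult f g)
  then obtain c C d D where cd: "c > 0" "C > 0" "d > 0" "D > 0"
    and f: "\<And>x. \<bar>f x\<bar> \<le> C * exp (c * norm x)" and g: "\<And>x. \<bar>g x\<bar> \<le> D * exp (d * norm x)"
    by blast
  have "\<bar>f x * g x\<bar> \<le> (C * D) * exp ((c + d) * norm x)" for x
  proof -
    have "\<bar>f x\<bar> * \<bar>g x\<bar> \<le> (C * exp (c * norm x)) * (D * exp (d * norm x))"
      using cd by (intro mult_mono f g) auto
    then show ?thesis
      by (simp add: abs_mult algebra_simps exp_add)
  qed
  then show ?case
    using cd by (intro exI[of _ "c + d"] exI[of _ "C * D"] conjI) auto
qed

lemma P_E_iff:
  fixes \<omega> :: "'a::euclidean_space \<Rightarrow> real"
  shows "\<omega> \<in> P_E \<longleftrightarrow> weight \<omega> \<and> (\<exists>c>0. \<exists>C>0. \<forall>x y. \<omega> (x + y) \<le> C * \<omega> x * exp (c * norm y))"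
    (is "_ \<longleftrightarrow> _ \<and> ?M")
proof -
  have "(\<exists>c>0. \<exists>C>0. moderate (\<lambda>x. C * exp (c * norm x)) \<omega>) \<longleftrightarrow> ?M" if "weight \<omega>"
  proof
    assume "\<exists>c>0. \<exists>C>0. moderate (\<lambda>x. C * exp (c * norm x)) \<omega>"
    then obtain c C D where "c > 0" "C > 0" "D > 0"
      "\<forall>x y. \<omega> (x + y) \<le> D * \<omega> x * (C * exp (c * norm y))"
      unfolding moderate_def by blast
    then show ?M
      by (intro exI[of _ c] conjI exI[of _ "C * D"]) (auto simp: algebra_simps)
  next
    assume ?M
    then obtain c C where c: "c > 0" "C > 0" "\<forall>x y. \<omega> (x + y) \<le> C * \<omega> x * exp (c * norm y)"
      by blast
    have "Linf_loc (\<lambda>x::'a. 1 * exp (c * norm x))"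
      by (intro continuous_imp_Linf_loc continuous_intros)
    with c have "moderate (\<lambda>x. 1 * exp (c * norm x)) \<omega>"
      unfolding moderate_def by auto
    with c(1) show "\<exists>c>0. \<exists>C>0. moderate (\<lambda>x. C * exp (c * norm x)) \<omega>"
      using zero_less_one by blast
  qed
  then show ?thesis
    unfolding P_E_def by auto
qed

lemma P_poly_subset_P_E: "P_poly \<subseteq> P_E"
proof
  fix \<omega> :: "'a \<Rightarrow> real"
  assume "\<omega> \<in> P_poly"
  then obtain v where w: "weight \<omega>" and v: "real_polynomial_function v" and mod: "moderate v \<omega>"
    unfolding P_poly_def by blast
  obtain D where D: "D > 0" and m: "\<And>x y. \<omega> (x + y) \<le> D * \<omega> x * v y"
    using mod unfolding moderate_def by auto
  obtain c C where c: "c > 0" "C > 0" and b: "\<And>x. \<bar>v x\<bar> \<le> C * exp (c * norm x)"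
    using real_polynomial_function_exp_bound[OF v] by blast
  have "\<omega> (x + y) \<le> (D * C) * \<omega> x * exp (c * norm y)" for x y
  proof -
    have "D * \<omega> x * v y \<le> D * \<omega> x * (C * exp (c * norm y))"
      using b[of y] D w by (intro mult_left_mono) (auto simp: weight_def less_imp_le)
    then show ?thesis
      using m[of x y] by (simp add: algebra_simps)
  qed
  then show "\<omega> \<in> P_E"
    unfolding P_E_iff using w c D by (intro conjI exI[of _ c] exI[of _ "D * C"]) auto
qed

text \<open>
  Moderateness at the origin bounds \<open>\<omega>\<close> above at every point of a compact set, and not merely
  almost everywhere. This is what the lower bound in the definition of a weight requires
  of \<open>1 / \<omega>\<close>.
\<close>

lemma P_E_inverse:
  fixes \<omega> :: "'a::euclidean_space \<Rightarrow> real"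
  assumes "\<omega> \<in> P_E"
  shows "(\<lambda>x. 1 / \<omega> x) \<in> P_E"
proof -
  obtain c C where w: "weight \<omega>" and c: "c > 0" "C > 0"
    and m: "\<And>x y. \<omega> (x + y) \<le> C * \<omega> x * exp (c * norm y)"
    using assms unfolding P_E_iff by blast
  have pos: "\<And>x. \<omega> x > 0" and meas: "\<omega> \<in> borel_measurable lebesgue"
    using w by (auto simp: weight_def Linf_loc_def)
  have "1 / \<omega> (x + y) \<le> C * (1 / \<omega> x) * exp (c * norm y)" for x y
  proof -
    have "\<omega> x \<le> C * \<omega> (x + y) * exp (c * norm y)"
      using m[of "x + y" "- y"] by simp
    then show ?thesis
      using pos[of x] pos[of "x + y"] by (simp add: field_simps)
  qed
  moreover have "weight (\<lambda>x. 1 / \<omega> x)"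
    unfolding weight_def Linf_loc_def
  proof (intro conjI allI impI)
    show "0 < 1 / \<omega> x" for x
      using pos by simp
    show "(\<lambda>x. 1 / \<omega> x) \<in> borel_measurable lebesgue"
      using meas by measurable
    fix K :: "'a set"
    assume K: "compact K"
    obtain b where b: "b > 0" "\<forall>x\<in>K. b \<le> \<omega> x"
      using w K unfolding weight_def by blast
    have "\<bar>1 / \<omega> x\<bar> \<le> 1 / b" if "x \<in> K" for x
      using b that pos[of x] by (simp add: frac_le)
    then show "\<exists>B. AE x in lebesgue. x \<in> K \<longrightarrow> \<bar>1 / \<omega> x\<bar> \<le> B"
      by (intro exI[of _ "1 / b"]) auto
    obtain R where R: "\<forall>x\<in>K. norm x \<le> R"
      using K compact_imp_bounded bounded_iff by metis
    have "1 / (C * \<omega> 0 * exp (c * R)) \<le> 1 / \<omega> x" if "x \<in> K" for x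
    proof -
      have "\<omega> x \<le> C * \<omega> 0 * exp (c * norm x)"
        using m[of 0 x] by simp
      also have "\<dots> \<le> C * \<omega> 0 * exp (c * R)"
        using R that c pos[of 0] by (intro mult_left_mono) auto
      finally show ?thesis
        using pos[of x] by (simp add: frac_le)
    qed
    moreover have "1 / (C * \<omega> 0 * exp (c * R)) > 0"
      using c pos[of 0] by simp
    ultimately show "\<exists>b>0. \<forall>x\<in>K. b \<le> 1 / \<omega> x"
      by blast
  qed
  ultimately show ?thesis
    unfolding P_E_iff using c by blast
qed

lemma linear_le_quadratic:
  fixes a d r :: real
  assumes "d > 0"
  shows "a * r \<le> d * r\<^sup>2 + a\<^sup>2 / (4 * d)"
proof -
  have "d * r\<^sup>2 + a\<^sup>2 / (4 * d) - a * r = (2 * d * r - a)\<^sup>2 / (4 * d)"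
    using assms by (simp add: power2_eq_square field_simps)
  then show ?thesis
    using assms by (smt (verit) divide_nonneg_pos zero_le_power2)
qed

lemma P_E_subset_P_G0: "P_E \<subseteq> P_G0"
proof
  fix \<omega> :: "'a \<Rightarrow> real"
  assume "\<omega> \<in> P_E"
  then obtain c C where w: "weight \<omega>" and c: "c > 0" "C > 0"
    and m: "\<And>x y. \<omega> (x + y) \<le> C * \<omega> x * exp (c * norm y)"
    unfolding P_E_iff by blast
  have pos: "\<And>x. \<omega> x > 0"
    using w by (auto simp: weight_def)
  have m': "\<omega> x \<le> C * \<omega> (x + y) * exp (c * norm y)" for x y
    using m[of "x + y" "- y"] by simp
  have "cond_L \<omega>"
    unfolding cond_L_def
  proof (intro exI conjI allI impI)
    let ?D = "C * exp c"
    fix x y :: 'a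
    assume h: "norm x \<ge> 2 * 1" "norm y \<le> 1 / norm x"
    have "1 / norm x \<le> 1"
      using h(1) by (simp add: divide_le_eq_1)
    then have e: "exp (c * norm y) \<le> exp c"
      using h(2) c by simp
    have "C * \<omega> (x + y) * exp (c * norm y) \<le> C * \<omega> (x + y) * exp c"
      using e c pos[of "x + y"] by (intro mult_left_mono) auto
    then have "\<omega> x \<le> ?D * \<omega> (x + y)"
      using m'[of x y] by (simp add: algebra_simps)
    then show "inverse ?D * \<omega> x \<le> \<omega> (x + y)"
      using c by (simp add: field_simps)
    have "C * \<omega> x * exp (c * norm y) \<le> C * \<omega> x * exp c"
      using e c pos[of x] by (intro mult_left_mono) auto
    then show "\<omega> (x + y) \<le> ?D * \<omega> x"
      using m[of x y] by (simp add: algebra_simps)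
  qed (use c in auto)
  moreover have "\<exists>D>0. cond_E d D \<omega>" if d: "d > 0" for d
  proof -
    define E where "E = exp (c\<^sup>2 / (4 * d))"
    \<comment> \<open>The two summands serve the upper and the lower bound, respectively.\<close>
    define D where "D = C * \<omega> 0 * E + C * E / \<omega> 0"
    have p: "C * \<omega> 0 * E > 0" "C * E / \<omega> 0 > 0"
      using c pos[of 0] by (auto simp: E_def)
    then have D: "D > 0"
      by (simp add: D_def)
    have "cond_E d D \<omega>"
      unfolding cond_E_def
    proof (intro allI conjI)
      fix x :: 'a
      have e: "exp (c * norm x) \<le> E * exp (d * (norm x)\<^sup>2)"
        unfolding E_def exp_add[symmetric] exp_le_cancel_iff
        using linear_le_quadratic[OF d, of c "norm x"] by linarith
      have "\<omega> x \<le> C * \<omega> 0 * exp (c * norm x)"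
        using m[of 0 x] by simp
      also have "\<dots> \<le> C * \<omega> 0 * (E * exp (d * (norm x)\<^sup>2))"
        using e c pos[of 0] by (intro mult_left_mono) auto
      also have "\<dots> = (C * \<omega> 0 * E) * exp (d * (norm x)\<^sup>2)"
        by simp
      also have "\<dots> \<le> D * exp (d * (norm x)\<^sup>2)"
        using p by (intro mult_right_mono) (auto simp: D_def)
      finally show "\<omega> x \<le> D * exp (d * (norm x)\<^sup>2)" .
      have "\<omega> 0 \<le> C * \<omega> x * exp (c * norm x)"
        using m'[of 0 x] by simp
      also have "\<dots> \<le> C * \<omega> x * (E * exp (d * (norm x)\<^sup>2))"
        using e c pos[of x] by (intro mult_left_mono) auto
      finally have "1 \<le> (C * E / \<omega> 0) * (\<omega> x * exp (d * (norm x)\<^sup>2))"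
        using pos[of 0] by (simp add: field_simps)
      also have "\<dots> \<le> D * (\<omega> x * exp (d * (norm x)\<^sup>2))"
        using p pos[of x] by (intro mult_right_mono) (auto simp: D_def)
      finally show "inverse D * exp (- d * (norm x)\<^sup>2) \<le> \<omega> x"
        using D by (simp add: exp_minus field_simps)
    qed
    with D show ?thesis
      by blast
  qed
  ultimately show "\<omega> \<in> P_G0"
    using w by (simp add: P_G0_def)
qed

text \<open>
  Moderateness only controls \<open>\<omega>\<close> up to the constant \<open>C\<close>, which does not tend to \<open>1\<close> for short
  translations. The least function above \<open>\<omega>\<close> whose logarithm is \<open>c\<close>-Lipschitz removes the constant
  at the price of passing to an equivalent weight.
\<close>

lemma log_Lipschitz_regularisation:
  fixes \<omega> :: "'a::euclidean_space \<Rightarrow> real"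
  assumes "\<omega> \<in> P_E"
  obtains \<omega>0 c where "c > 0" "weight \<omega>0" "continuous_on UNIV \<omega>0" "equivalent_weights \<omega> \<omega>0"
    "\<And>x y. \<omega>0 (x + y) \<le> \<omega>0 x * exp (c * norm y)"
proof -
  obtain c C where w: "weight \<omega>" and c: "c > 0" "C > 0"
    and m: "\<And>x y. \<omega> (x + y) \<le> C * \<omega> x * exp (c * norm y)"
    using assms unfolding P_E_iff by blast
  have pos: "\<And>x. \<omega> x > 0"
    using w by (auto simp: weight_def)
  define \<omega>0 where "\<omega>0 = (\<lambda>x. SUP z. \<omega> z * exp (- c * norm (x - z)))"
  have bound: "\<omega> z * exp (- c * norm (x - z)) \<le> C * \<omega> x" for x z
    using m[of x "z - x"] by (simp add: exp_minus field_simps norm_minus_commute)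
  have bdd: "bdd_above (range (\<lambda>z. \<omega> z * exp (- c * norm (x - z))))" for x
    using bound by (intro bdd_aboveI[of _ "C * \<omega> x"]) auto
  have upper: "\<omega>0 x \<le> C * \<omega> x" for x
    unfolding \<omega>0_def by (intro cSUP_least bound) auto
  have lower: "\<omega> x \<le> \<omega>0 x" for x
    unfolding \<omega>0_def using cSUP_upper[OF UNIV_I bdd, of x x] by simp
  have pos0: "\<omega>0 x > 0" for x
    using lower[of x] pos[of x] by linarith
  have lip: "\<omega>0 (x + y) \<le> \<omega>0 x * exp (c * norm y)" for x y
    unfolding \<omega>0_def[THEN fun_cong, of "x + y"]
  proof (rule cSUP_least)
    fix z
    have "norm (x - z) \<le> norm (x + y - z) + norm y"
      using norm_triangle_ineq4[of "x + y - z" y] by (simp add: algebra_simps)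
    then have "c * norm (x - z) \<le> c * (norm (x + y - z) + norm y)"
      using c by (intro mult_left_mono) auto
    then have "exp (- c * norm (x + y - z)) \<le> exp (- c * norm (x - z)) * exp (c * norm y)"
      unfolding exp_add[symmetric] exp_le_cancel_iff by (simp add: algebra_simps)
    then have "\<omega> z * exp (- c * norm (x + y - z)) \<le>
        \<omega> z * (exp (- c * norm (x - z)) * exp (c * norm y))"
      using pos[of z] by (intro mult_left_mono) auto
    also have "\<dots> = (\<omega> z * exp (- c * norm (x - z))) * exp (c * norm y)"
      by simp
    also have "\<dots> \<le> \<omega>0 x * exp (c * norm y)"
      unfolding \<omega>0_def by (intro mult_right_mono cSUP_upper bdd) auto
    finally show "\<omega> z * exp (- c * norm (x + y - z)) \<le> \<omega>0 x * exp (c * norm y)" .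
  qed simp
  have cont: "continuous_on UNIV \<omega>0"
    unfolding continuous_on_def
  proof
    fix x :: 'a
    have t: "((\<lambda>y. \<omega>0 x * exp (s * norm (y - x))) \<longlongrightarrow> \<omega>0 x) (at x)" for s
      by (rule tendsto_eq_intros refl | simp)+
    have "\<omega>0 x * exp (- c * norm (y - x)) \<le> \<omega>0 y" for y
      using lip[of y "x - y"] by (simp add: exp_minus field_simps norm_minus_commute)
    moreover have "\<omega>0 y \<le> \<omega>0 x * exp (c * norm (y - x))" for y
      using lip[of x "y - x"] by simp
    ultimately show "(\<omega>0 \<longlongrightarrow> \<omega>0 x) (at x within UNIV)"
      by (intro tendsto_sandwich[OF _ _ t[of "- c"] t[of c]] always_eventually allI)
  qed
  have "equivalent_weights \<omega> \<omega>0"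
    unfolding equivalent_weights_def
  proof (intro exI conjI allI)
    fix x
    have "C + 1 > 0" "\<omega>0 x \<le> (C + 1) * \<omega> x"
      using c upper[of x] pos[of x] by (auto simp: algebra_simps)
    then show "inverse (C + 1) * \<omega>0 x \<le> \<omega> x"
      by (simp add: field_simps)
    show "\<omega> x \<le> (C + 1) * \<omega>0 x"
      using lower[of x] mult_pos_pos[OF c(2) pos0[of x]] by (simp add: algebra_simps)
  qed (use c in simp)
  with continuous_pos_imp_weight[OF cont pos0] show thesis
    using that c(1) cont lip by blast
qed

section \<open>Weights that vary tamely along rays\<close>

text \<open>
  The factor \<open>1 - l\<^sup>2\<close> multiplies the constant \<open>K\<close> as well as the quadratic term, so that the
  bound tends to \<open>1\<close> with \<open>l\<close> once the quadratic term has been compensated.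
\<close>

definition radially_tame :: "('a::euclidean_space \<Rightarrow> real) \<Rightarrow> bool" where
  "radially_tame \<omega> \<longleftrightarrow> (\<forall>\<delta>>0. \<exists>K\<ge>0. \<forall>l x. 0 < l \<longrightarrow> l < 1 \<longrightarrow>
     \<omega> x \<le> \<omega> (l *\<^sub>R x) * exp ((1 - l\<^sup>2) * (\<delta> * (norm x)\<^sup>2 + K)))"

lemma radially_tame_dilation_quotient:
  fixes \<omega> :: "'a::euclidean_space \<Rightarrow> real"
  assumes tame: "radially_tame \<omega>" and pos: "\<And>x. \<omega> x > 0" and eps: "\<epsilon> > 0"
  obtains K where "K \<ge> 0"
    "\<And>l x. 0 < l \<Longrightarrow> l < 1 \<Longrightarrow> dilation_quotient \<epsilon> \<omega> l x \<le> exp ((1 - l\<^sup>2) * K)"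
proof -
  \<comment> \<open>The point is \<open>sqrt 2 x\<close>, so \<open>\<epsilon> / 4\<close> produces exactly the exponent \<open>\<epsilon> (1 - l\<^sup>2) |x|\<^sup>2 / 2\<close>.\<close>
  obtain K where K: "K \<ge> 0" and b: "\<And>l x. 0 < l \<Longrightarrow> l < 1 \<Longrightarrow>
      \<omega> x \<le> \<omega> (l *\<^sub>R x) * exp ((1 - l\<^sup>2) * (\<epsilon> / 4 * (norm x)\<^sup>2 + K))"
    using tame eps unfolding radially_tame_def by (metis divide_pos_pos zero_less_numeral)
  have "dilation_quotient \<epsilon> \<omega> l x \<le> exp ((1 - l\<^sup>2) * K)" if l: "0 < l" "l < 1" for l x
  proof -
    have "\<omega> (sqrt 2 *\<^sub>R x) \<le> \<omega> ((sqrt 2 * l) *\<^sub>R x) * exp ((1 - l\<^sup>2) * (\<epsilon> / 2 * (norm x)\<^sup>2 + K))"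
      using b[OF l, of "sqrt 2 *\<^sub>R x"] by (simp add: power_mult_distrib mult.commute)
    moreover have "exp ((1 - l\<^sup>2) * (\<epsilon> / 2 * (norm x)\<^sup>2 + K)) * exp (- \<epsilon> * (1 - l\<^sup>2) * (norm x)\<^sup>2 / 2)
        = exp ((1 - l\<^sup>2) * K)"
      unfolding exp_add[symmetric] by (simp add: field_simps)
    ultimately have "\<omega> (sqrt 2 *\<^sub>R x) * exp (- \<epsilon> * (1 - l\<^sup>2) * (norm x)\<^sup>2 / 2) \<le>
        \<omega> ((sqrt 2 * l) *\<^sub>R x) * exp ((1 - l\<^sup>2) * K)"
      by (metis (no_types, lifting) exp_ge_zero mult.assoc mult_right_mono)
    then show ?thesis
      unfolding dilation_quotient_def using pos[of "(sqrt 2 * l) *\<^sub>R x"]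
      by (simp add: divide_le_eq mult.commute)
  qed
  with K show thesis
    by (rule that)
qed

lemma dilation_quotient_zero:
  "\<omega> 0 > 0 \<Longrightarrow> dilation_quotient \<epsilon> \<omega> l 0 = 1"
  by (simp add: dilation_quotient_def)

lemma orthogonal_comp_zero: "orthogonal_comp {0} = UNIV"
  by (auto simp: orthogonal_comp_def orthogonal_def)

lemma radially_tame_imp_narrowly_dilated_suitable:
  fixes \<omega> :: "'a::euclidean_space \<Rightarrow> real"
  assumes Q0: "\<omega> \<in> P_Q0" and w0: "weight \<omega>0" and cont: "continuous_on UNIV \<omega>0"
    and eq: "equivalent_weights \<omega> \<omega>0" and tame: "radially_tame \<omega>0" and eps: "\<epsilon> > 0"
  shows "narrowly_dilated_suitable \<epsilon> {0} \<omega>"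
proof -
  have pos: "\<And>x. \<omega> x > 0" and pos0: "\<And>x. \<omega>0 x > 0"
    using Q0 w0 by (auto simp: P_Q0_def weight_def)
  obtain K where K: "K \<ge> 0" and
    b: "\<And>l x. 0 < l \<Longrightarrow> l < 1 \<Longrightarrow> dilation_quotient \<epsilon> \<omega>0 l x \<le> exp ((1 - l\<^sup>2) * K)"
    using radially_tame_dilation_quotient[OF tame pos0 eps] by blast
  obtain C where C: "C > 0" and eqC: "\<And>x. inverse C * \<omega>0 x \<le> \<omega> x \<and> \<omega> x \<le> C * \<omega>0 x"
    using eq unfolding equivalent_weights_def by blast
  have "dilated_suitable \<epsilon> \<omega>"
    unfolding dilated_suitable_def
  proof (intro conjI exI allI impI)
    show "0 < C\<^sup>2 * exp K"
      using C by simp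
    fix l :: real and x :: 'a
    assume l: "1 - 1/2 < l" "l < 1"
    define G where "G = exp (- \<epsilon> * (1 - l\<^sup>2) * (norm x)\<^sup>2 / 2)"
    have "\<omega> (sqrt 2 *\<^sub>R x) * G / \<omega> ((sqrt 2 * l) *\<^sub>R x) \<le>
        (C * \<omega>0 (sqrt 2 *\<^sub>R x)) * G / (inverse C * \<omega>0 ((sqrt 2 * l) *\<^sub>R x))"
      using eqC[of "sqrt 2 *\<^sub>R x"] eqC[of "(sqrt 2 * l) *\<^sub>R x"] C
        pos0[of "sqrt 2 *\<^sub>R x"] pos0[of "(sqrt 2 * l) *\<^sub>R x"]
      by (intro frac_le mult_right_mono) (auto simp: G_def)
    also have "\<dots> = C\<^sup>2 * (\<omega>0 (sqrt 2 *\<^sub>R x) * G / \<omega>0 ((sqrt 2 * l) *\<^sub>R x))"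
      using C by (simp add: field_simps power2_eq_square)
    finally have "dilation_quotient \<epsilon> \<omega> l x \<le> C\<^sup>2 * dilation_quotient \<epsilon> \<omega>0 l x"
      unfolding dilation_quotient_def G_def .
    also have "\<dots> \<le> C\<^sup>2 * exp ((1 - l\<^sup>2) * K)"
      using b[of l x] l by (intro mult_left_mono) auto
    also have "\<dots> \<le> C\<^sup>2 * exp K"
      using K by (intro mult_left_mono) (auto simp: algebra_simps)
    finally show "dilation_quotient \<epsilon> \<omega> l x \<le> C\<^sup>2 * exp K" .
  qed (use Q0 in auto)
  moreover have "((\<lambda>l. SUP x. ereal (dilation_quotient \<epsilon> \<omega>0 l x)) \<longlongrightarrow> 1) (at_left 1)"
  proof (rule tendsto_sandwich)
    show "\<forall>\<^sub>F l in at_left 1. 1 \<le> (SUP x. ereal (dilation_quotient \<epsilon> \<omega>0 l x))"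
      by (intro always_eventually allI SUP_upper2[of 0])
        (auto simp: dilation_quotient_zero pos0 one_ereal_def)
    have "\<forall>\<^sub>F l in at_left 1. l \<in> {0<..<1::real}"
      by (rule eventually_at_leftI[of 0]) auto
    then show "\<forall>\<^sub>F l in at_left 1. (SUP x. ereal (dilation_quotient \<epsilon> \<omega>0 l x)) \<le>
        ereal (exp ((1 - l\<^sup>2) * K))"
      by eventually_elim (auto intro!: SUP_least b)
    have "((\<lambda>l::real. exp ((1 - l\<^sup>2) * K)) \<longlongrightarrow> 1) (at_left 1)"
      by (rule tendsto_eq_intros refl | simp)+
    then show "((\<lambda>l. ereal (exp ((1 - l\<^sup>2) * K))) \<longlongrightarrow> 1) (at_left 1)"
      unfolding one_ereal_def by (rule tendsto_ereal)
  qed (rule tendsto_const)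
  ultimately show ?thesis
    unfolding narrowly_dilated_suitable_def using w0 cont eq
    by (auto simp: orthogonal_comp_zero intro!: exI[of _ \<omega>0] exI[of _ 1])
qed

section \<open>Dependence on the subspace\<close>

text \<open>
  The supremum over the affine subspace through \<open>x1\<close> lies between the quotient at \<open>x1\<close>, which
  tends to \<open>1\<close> by continuity, and the supremum over the whole space, whose limit is at most \<open>1\<close>.
\<close>

lemma narrowly_dilated_suitable_zero_imp:
  fixes \<omega> :: "'a::euclidean_space \<Rightarrow> real"
  assumes "narrowly_dilated_suitable \<epsilon> {0} \<omega>"
  shows "narrowly_dilated_suitable \<epsilon> V \<omega>"
proof -
  let ?q = "\<lambda>\<omega>0 l x. ereal (dilation_quotient \<epsilon> \<omega>0 l x)"
  obtain \<omega>0 L where ds: "dilated_suitable \<epsilon> \<omega>" and w0: "weight \<omega>0" and cont: "continuous_on UNIV \<omega>0"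
    and eq: "equivalent_weights \<omega> \<omega>0" and L: "L \<le> 1"
    and lim: "((\<lambda>l. SUP x. ?q \<omega>0 l x) \<longlongrightarrow> L) (at_left 1)"
    using assms unfolding narrowly_dilated_suitable_def by (auto simp: orthogonal_comp_zero)
  have pos0: "\<And>x. \<omega>0 x > 0"
    using w0 by (auto simp: weight_def)
  have point: "((\<lambda>l. ?q \<omega>0 l x) \<longlongrightarrow> 1) (at_left 1)" for x
  proof -
    have "isCont \<omega>0 ((sqrt 2 * 1) *\<^sub>R x)"
      using cont by (simp add: continuous_on_eq_continuous_at)
    moreover have "((\<lambda>l. (sqrt 2 * l) *\<^sub>R x) \<longlongrightarrow> (sqrt 2 * 1) *\<^sub>R x) (at_left 1)"
      by (intro tendsto_intros)
    ultimately have "((\<lambda>l. \<omega>0 ((sqrt 2 * l) *\<^sub>R x)) \<longlongrightarrow> \<omega>0 ((sqrt 2 * 1) *\<^sub>R x)) (at_left 1)"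
      by (rule isCont_tendsto_compose)
    then have "((\<lambda>l. dilation_quotient \<epsilon> \<omega>0 l x) \<longlongrightarrow> \<omega>0 (sqrt 2 *\<^sub>R x) *
        exp (- \<epsilon> * (1 - 1\<^sup>2) * (norm x)\<^sup>2 / 2) / \<omega>0 ((sqrt 2 * 1) *\<^sub>R x)) (at_left 1)"
      unfolding dilation_quotient_def using pos0[of "sqrt 2 *\<^sub>R x"] by (intro tendsto_intros) auto
    then have "((\<lambda>l. dilation_quotient \<epsilon> \<omega>0 l x) \<longlongrightarrow> 1) (at_left 1)"
      using pos0[of "sqrt 2 *\<^sub>R x"] by simp
    then show ?thesis
      unfolding one_ereal_def by (rule tendsto_ereal)
  qed
  have "1 \<le> L"
    by (rule tendsto_le[OF _ lim point[of 0]]) (auto intro!: always_eventually SUP_upper)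
  with L lim have lim1: "((\<lambda>l. SUP x. ?q \<omega>0 l x) \<longlongrightarrow> 1) (at_left 1)"
    by simp
  have "((\<lambda>l. SUP x2\<in>orthogonal_comp V. ?q \<omega>0 l (x1 + x2)) \<longlongrightarrow> 1) (at_left 1)" for x1
  proof (rule tendsto_sandwich[OF _ _ point[of x1] lim1]; intro always_eventually allI)
    have "0 \<in> orthogonal_comp V"
      by (simp add: orthogonal_comp_def orthogonal_def)
    then show "?q \<omega>0 l x1 \<le> (SUP x2\<in>orthogonal_comp V. ?q \<omega>0 l (x1 + x2))" for l
      by (rule SUP_upper2) simp
    show "(SUP x2\<in>orthogonal_comp V. ?q \<omega>0 l (x1 + x2)) \<le> (SUP x. ?q \<omega>0 l x)" for l
      by (intro SUP_least SUP_upper UNIV_I)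
  qed
  with ds w0 cont eq show ?thesis
    unfolding narrowly_dilated_suitable_def by (meson order_refl)
qed

lemma P_D0_subset_P_DV0: "P_D0 \<subseteq> P_DV0 V"
  unfolding P_D0_def P_DV0_def using narrowly_dilated_suitable_zero_imp by blast

lemma P_DV0_subset_P_D: "P_DV0 V \<subseteq> P_D"
  unfolding P_DV0_def P_D_def narrowly_dilated_suitable_def by blast

section \<open>Tameness of the two families of weights\<close>

lemma log_Lipschitz_imp_radially_tame:
  fixes \<omega> :: "'a::euclidean_space \<Rightarrow> real"
  assumes c: "c > 0" and pos: "\<And>x. \<omega> x > 0"
    and lip: "\<And>x y. \<omega> (x + y) \<le> \<omega> x * exp (c * norm y)"
  shows "radially_tame \<omega>"
  unfolding radially_tame_def
proof (intro allI impI exI conjI)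
  fix \<delta> :: real
  assume d: "\<delta> > 0"
  show "0 \<le> c\<^sup>2 / (4 * \<delta>)"
    using d by simp
  fix l :: real and x :: 'a
  assume l: "0 < l" "l < 1"
  have "l\<^sup>2 \<le> l"
    using l by (simp add: power2_eq_square)
  then have "(1 - l) * (c * norm x) \<le> (1 - l\<^sup>2) * (c * norm x)"
    using c by (intro mult_right_mono) auto
  also have "\<dots> \<le> (1 - l\<^sup>2) * (\<delta> * (norm x)\<^sup>2 + c\<^sup>2 / (4 * \<delta>))"
    using linear_le_quadratic[OF d, of c "norm x"] l
    by (intro mult_left_mono) (auto simp: power_le_one)
  finally have "c * norm ((1 - l) *\<^sub>R x) \<le> (1 - l\<^sup>2) * (\<delta> * (norm x)\<^sup>2 + c\<^sup>2 / (4 * \<delta>))"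
    using l by (simp add: mult.left_commute)
  then have "\<omega> (l *\<^sub>R x) * exp (c * norm ((1 - l) *\<^sub>R x)) \<le>
      \<omega> (l *\<^sub>R x) * exp ((1 - l\<^sup>2) * (\<delta> * (norm x)\<^sup>2 + c\<^sup>2 / (4 * \<delta>)))"
    using pos[of "l *\<^sub>R x"] by (intro mult_left_mono) auto
  moreover have "l *\<^sub>R x + (1 - l) *\<^sub>R x = x"
    by (simp add: algebra_simps)
  ultimately show "\<omega> x \<le> \<omega> (l *\<^sub>R x) * exp ((1 - l\<^sup>2) * (\<delta> * (norm x)\<^sup>2 + c\<^sup>2 / (4 * \<delta>)))"
    using lip[of "l *\<^sub>R x" "(1 - l) *\<^sub>R x"] by simp
qed

lemma P_E_subset_P_D0: "P_E \<subseteq> P_D0"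
proof
  fix \<omega> :: "'a \<Rightarrow> real"
  assume \<omega>: "\<omega> \<in> P_E"
  have nds: "narrowly_dilated_suitable \<epsilon> {0} u" if u: "u \<in> P_E" and eps: "\<epsilon> > 0"
    for u :: "'a \<Rightarrow> real" and \<epsilon>
  proof -
    obtain c \<omega>0 where h: "c > 0" "weight \<omega>0" "continuous_on UNIV \<omega>0" "equivalent_weights u \<omega>0"
      "\<And>x y. \<omega>0 (x + y) \<le> \<omega>0 x * exp (c * norm y)"
      by (rule log_Lipschitz_regularisation[OF u]) (rule that; simp)
    then have "radially_tame \<omega>0"
      by (intro log_Lipschitz_imp_radially_tame) (auto simp: weight_def)
    with h u eps show ?thesis
      using P_E_subset_P_G0 P_G0_subset_P_Q0
      by (intro radially_tame_imp_narrowly_dilated_suitable[of u \<omega>0]) auto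
  qed
  show "\<omega> \<in> P_D0"
    unfolding P_D0_def P_DV0_def
    using nds[OF \<omega>] nds[OF P_E_inverse[OF \<omega>]] \<omega> P_E_subset_P_G0 P_G0_subset_P_Q0 by blast
qed

lemma norm_pow_nonneg: "norm_pow x \<gamma> \<ge> 0"
  by (simp add: norm_pow_def)

lemma norm_pow_scaleR:
  assumes "l > 0"
  shows "norm_pow (l *\<^sub>R x) \<gamma> = l powr \<gamma> * norm_pow x \<gamma>"
  using assms by (simp add: norm_pow_def powr_mult)

lemma continuous_on_norm_pow:
  assumes "\<gamma> \<ge> 0"
  shows "continuous_on UNIV (\<lambda>x. norm_pow x \<gamma>)"
proof (cases "\<gamma> = 0")
  case False
  then show ?thesis
    unfolding norm_pow_def using assms
    by (auto intro!: continuous_on_powr' continuous_on_norm_id continuous_on_const)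
qed (simp add: norm_pow_def)

lemma norm_pow_subquadratic:
  fixes \<gamma> \<delta> :: real
  assumes \<gamma>: "0 \<le> \<gamma>" "\<gamma> < 2" and d: "\<delta> > 0"
  obtains K where "K \<ge> 0" "\<And>x :: 'a::real_normed_vector. norm_pow x \<gamma> \<le> \<delta> * (norm x)\<^sup>2 + K"
proof -
  \<comment> \<open>The radius at which \<open>r\<^sup>\<gamma> = \<delta> r\<^sup>2\<close>: beyond it the quadratic term dominates. The summand \<open>1\<close> in
    the constant below serves \<open>\<gamma> = 0\<close> at the origin.\<close>
  define R where "R = (1 / \<delta>) powr (1 / (2 - \<gamma>))"
  have R: "R > 0" "R powr (2 - \<gamma>) = 1 / \<delta>"
    using \<gamma> d by (auto simp: R_def powr_powr)
  have "norm_pow x \<gamma> \<le> \<delta> * (norm x)\<^sup>2 + (R powr \<gamma> + 1)" for x :: 'a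
  proof (cases "\<gamma> = 0")
    case True
    then show ?thesis
      using d by (simp add: norm_pow_def add_increasing)
  next
    case False
    show ?thesis
    proof (cases "norm x \<le> R")
      case True
      then have "norm x powr \<gamma> \<le> R powr \<gamma>"
        using \<gamma> by (intro powr_mono2) auto
      then show ?thesis
        using False d by (simp add: norm_pow_def add_increasing)
    next
      case big: False
      then have x: "norm x > 0"
        using R(1) by linarith
      have "1 = \<delta> * R powr (2 - \<gamma>)"
        using R(2) d by simp
      also have "\<dots> \<le> \<delta> * norm x powr (2 - \<gamma>)"
        using big R(1) \<gamma> d by (intro mult_left_mono powr_mono2) auto
      finally have "norm x powr \<gamma> \<le> \<delta> * norm x powr (2 - \<gamma>) * norm x powr \<gamma>"
        using mult_right_mono[of 1 "\<delta> * norm x powr (2 - \<gamma>)" "norm x powr \<gamma>"] by simp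
      also have "\<dots> = \<delta> * (norm x)\<^sup>2"
        using x by (simp add: mult.assoc powr_add[symmetric])
      finally show ?thesis
        using False R(1) by (simp add: norm_pow_def add_increasing2)
    qed
  qed
  moreover have "R powr \<gamma> + 1 \<ge> 0"
    by (simp add: add_nonneg_nonneg)
  ultimately show thesis
    by (rule that[rotated])
qed

text \<open>
  Relative perturbations of \<open>|x|\<close> have size \<open>|x|\<^sup>-\<^sup>2\<close>, and \<open>|x|\<^sup>\<gamma>\<close> with \<open>\<gamma> \<le> 2\<close> is at most
  \<open>|x|\<^sup>2\<close> away from the origin, so the perturbation of the power is bounded. Comparing
  with the square avoids the mean value theorem.
\<close>

lemma norm_pow_short_translation:
  fixes x y :: "'a::real_normed_vector"
  assumes \<gamma>: "0 \<le> \<gamma>" "\<gamma> \<le> 2" and x: "norm x \<ge> 2" and y: "norm y \<le> 1 / norm x"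
  shows "\<bar>norm_pow (x + y) \<gamma> - norm_pow x \<gamma>\<bar> \<le> 3"
proof (cases "\<gamma> = 0")
  case False
  define a where "a = norm x"
  define b where "b = norm (x + y)"
  define s where "s = 1 / a\<^sup>2"
  have a: "a \<ge> 2"
    using x by (simp add: a_def)
  have s: "0 < s" "s < 1"
    using a by (auto simp: s_def power2_eq_square mult_less_cancel_left1 less_1_mult)
  have as: "a * s = 1 / a"
    using a by (simp add: s_def power2_eq_square)
  have ub: "b \<le> a * (1 + s)"
    using norm_triangle_ineq[of x y] y as unfolding a_def b_def by (simp add: algebra_simps)
  have lb: "a * (1 - s) \<le> b"
    using norm_diff_ineq[of x y] y as unfolding a_def b_def by (simp add: algebra_simps)
  have "a powr \<gamma> \<le> a powr 2"
    using a \<gamma> by (intro powr_mono) auto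
  then have "a powr \<gamma> * s \<le> a powr 2 * s"
    using s by (intro mult_right_mono) auto
  then have small: "a powr \<gamma> * s \<le> 1"
    using a by (simp add: s_def)
  have "s\<^sup>2 \<le> s"
    using s by (simp add: power2_eq_square)
  have "b powr \<gamma> \<le> (a * (1 + s)) powr \<gamma>"
    using ub \<gamma> by (intro powr_mono2) (auto simp: b_def)
  also have "\<dots> = a powr \<gamma> * (1 + s) powr \<gamma>"
    using a s by (simp add: powr_mult)
  also have "\<dots> \<le> a powr \<gamma> * (1 + s) powr 2"
    using \<gamma> s by (intro mult_left_mono powr_mono) auto
  also have "\<dots> \<le> a powr \<gamma> * (1 + 3 * s)"
    using s \<open>s\<^sup>2 \<le> s\<close> by (intro mult_left_mono) (auto simp: power2_eq_square algebra_simps)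
  finally have 1: "b powr \<gamma> \<le> a powr \<gamma> + 3"
    using small by (simp add: algebra_simps)
  have "a powr \<gamma> * (1 - 2 * s) \<le> a powr \<gamma> * (1 - s) powr 2"
    using s by (intro mult_left_mono) (auto simp: power2_eq_square algebra_simps)
  also have "\<dots> \<le> a powr \<gamma> * (1 - s) powr \<gamma>"
    using \<gamma> s by (intro mult_left_mono powr_mono') auto
  also have "\<dots> = (a * (1 - s)) powr \<gamma>"
    using a s by (simp add: powr_mult)
  also have "\<dots> \<le> b powr \<gamma>"
    using lb \<gamma> a s by (intro powr_mono2) auto
  finally have 2: "a powr \<gamma> - 2 \<le> b powr \<gamma>"
    using small by (simp add: algebra_simps)
  from 1 2 False show ?thesis
    by (simp add: norm_pow_def a_def b_def)
qed (simp add: norm_pow_def)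

lemma exp_norm_pow_weight:
  fixes C \<gamma> t :: real
  assumes "C > 0" "0 \<le> \<gamma>"
  shows "continuous_on UNIV (\<lambda>x :: 'a::euclidean_space. C * exp (t * norm_pow x \<gamma>))"
    and "weight (\<lambda>x :: 'a::euclidean_space. C * exp (t * norm_pow x \<gamma>))"
proof -
  show 1: "continuous_on UNIV (\<lambda>x :: 'a. C * exp (t * norm_pow x \<gamma>))"
    by (intro continuous_intros continuous_on_norm_pow assms)
  show "weight (\<lambda>x :: 'a. C * exp (t * norm_pow x \<gamma>))"
    by (rule continuous_pos_imp_weight[OF 1]) (use assms in simp)
qed

lemma abs_mult_norm_pow_subquadratic:
  fixes \<gamma> \<delta> t :: real
  assumes \<gamma>: "0 \<le> \<gamma>" "\<gamma> < 2" and d: "\<delta> > 0"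
  obtains K where "K \<ge> 0"
    "\<And>x :: 'a::real_normed_vector. \<bar>t\<bar> * norm_pow x \<gamma> \<le> \<delta> * (norm x)\<^sup>2 + K"
proof -
  define e where "e = \<delta> / (\<bar>t\<bar> + 1)"
  have e: "e > 0" "(\<bar>t\<bar> + 1) * e = \<delta>"
    using d by (auto simp: e_def)
  obtain K where K: "K \<ge> 0" "\<And>x :: 'a. norm_pow x \<gamma> \<le> e * (norm x)\<^sup>2 + K"
    using norm_pow_subquadratic[OF \<gamma> e(1)] by blast
  have "\<bar>t\<bar> * norm_pow x \<gamma> \<le> \<delta> * (norm x)\<^sup>2 + (\<bar>t\<bar> + 1) * K" for x :: 'a
  proof -
    have "\<bar>t\<bar> * norm_pow x \<gamma> \<le> (\<bar>t\<bar> + 1) * norm_pow x \<gamma>"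
      using norm_pow_nonneg[of x \<gamma>] by (intro mult_right_mono) auto
    also have "\<dots> \<le> (\<bar>t\<bar> + 1) * (e * (norm x)\<^sup>2 + K)"
      by (intro mult_left_mono K) auto
    also have "\<dots> = ((\<bar>t\<bar> + 1) * e) * (norm x)\<^sup>2 + (\<bar>t\<bar> + 1) * K"
      by (simp only: distrib_left mult.assoc)
    finally show ?thesis
      unfolding e(2) .
  qed
  then show thesis
    using K(1) by (intro that[of "(\<bar>t\<bar> + 1) * K"]) auto
qed

lemma exp_norm_pow_in_P_G0:
  fixes C \<gamma> t :: real
  assumes C: "C > 0" and \<gamma>: "0 \<le> \<gamma>" "\<gamma> < 2"
  shows "(\<lambda>x :: 'a::euclidean_space. C * exp (t * norm_pow x \<gamma>)) \<in> P_G0" (is "?w \<in> _")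
proof -
  have "cond_L ?w"
    unfolding cond_L_def
  proof (intro exI conjI allI impI)
    fix x y :: 'a
    assume h: "norm x \<ge> 2 * 1" "norm y \<le> 1 / norm x"
    let ?\<Delta> = "norm_pow (x + y) \<gamma> - norm_pow x \<gamma>"
    have "\<bar>t * ?\<Delta>\<bar> \<le> \<bar>t\<bar> * 3"
      unfolding abs_mult using norm_pow_short_translation[of \<gamma> x y] \<gamma> h
      by (intro mult_left_mono) auto
    then have b: "t * norm_pow (x + y) \<gamma> \<le> 3 * \<bar>t\<bar> + t * norm_pow x \<gamma>"
      "- (3 * \<bar>t\<bar>) + t * norm_pow x \<gamma> \<le> t * norm_pow (x + y) \<gamma>"
      by (auto simp: algebra_simps)
    have "exp (t * norm_pow (x + y) \<gamma>) \<le> exp (3 * \<bar>t\<bar>) * exp (t * norm_pow x \<gamma>)"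
      unfolding exp_add[symmetric] exp_le_cancel_iff by (rule b)
    then show "?w (x + y) \<le> exp (3 * \<bar>t\<bar>) * ?w x"
      using C by simp
    have "inverse (exp (3 * \<bar>t\<bar>)) * exp (t * norm_pow x \<gamma>) \<le> exp (t * norm_pow (x + y) \<gamma>)"
      unfolding exp_minus[symmetric] exp_add[symmetric] exp_le_cancel_iff by (rule b)
    then show "inverse (exp (3 * \<bar>t\<bar>)) * ?w x \<le> ?w (x + y)"
      using C by (simp add: mult.left_commute[of _ C])
  qed auto
  moreover have "\<exists>D>0. cond_E d D ?w" if d: "d > 0" for d
  proof -
    obtain K where K: "K \<ge> 0" "\<And>x :: 'a. \<bar>t\<bar> * norm_pow x \<gamma> \<le> d * (norm x)\<^sup>2 + K"
      using abs_mult_norm_pow_subquadratic[OF \<gamma> d] by blast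
    \<comment> \<open>\<open>\<bar>ln C\<bar>\<close> accounts for the factor \<open>C\<close> in both directions.\<close>
    have "cond_E d (exp (K + \<bar>ln C\<bar>)) ?w"
      unfolding cond_E_def
    proof (intro allI conjI)
      fix x :: 'a
      have "\<bar>t * norm_pow x \<gamma>\<bar> \<le> d * (norm x)\<^sup>2 + K"
        unfolding abs_mult using K(2)[of x] norm_pow_nonneg[of x \<gamma>] by simp
      then have b: "ln C + t * norm_pow x \<gamma> \<le> K + \<bar>ln C\<bar> + d * (norm x)\<^sup>2"
        "- (K + \<bar>ln C\<bar>) + - d * (norm x)\<^sup>2 \<le> ln C + t * norm_pow x \<gamma>"
        by auto
      have w: "?w x = exp (ln C + t * norm_pow x \<gamma>)"
        using C by (simp add: exp_add)
      show "?w x \<le> exp (K + \<bar>ln C\<bar>) * exp (d * (norm x)\<^sup>2)"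
        unfolding w exp_add[symmetric, of _ "d * (norm x)\<^sup>2"] exp_le_cancel_iff by (rule b)
      show "inverse (exp (K + \<bar>ln C\<bar>)) * exp (- d * (norm x)\<^sup>2) \<le> ?w x"
        unfolding w exp_minus[symmetric] exp_add[symmetric, of _ "- d * (norm x)\<^sup>2"]
          exp_le_cancel_iff by (rule b)
    qed
    then show ?thesis
      by (meson exp_gt_zero)
  qed
  ultimately show ?thesis
    using exp_norm_pow_weight(2)[OF C \<gamma>(1)] by (simp add: P_G0_def)
qed

lemma exp_norm_pow_radially_tame:
  fixes C \<gamma> t :: real
  assumes C: "C > 0" and \<gamma>: "0 \<le> \<gamma>" "\<gamma> < 2"
  shows "radially_tame (\<lambda>x :: 'a::euclidean_space. C * exp (t * norm_pow x \<gamma>))"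
  unfolding radially_tame_def
proof (intro allI impI)
  fix \<delta> :: real
  assume d: "\<delta> > 0"
  obtain K where K: "K \<ge> 0" "\<And>x :: 'a. \<bar>t\<bar> * norm_pow x \<gamma> \<le> \<delta> * (norm x)\<^sup>2 + K"
    using abs_mult_norm_pow_subquadratic[OF \<gamma> d] by blast
  have "C * exp (t * norm_pow x \<gamma>) \<le>
      C * exp (t * norm_pow (l *\<^sub>R x) \<gamma>) * exp ((1 - l\<^sup>2) * (\<delta> * (norm x)\<^sup>2 + K))"
    if l: "0 < l" "l < 1" for l and x :: 'a
  proof -
    have "l powr 2 \<le> l powr \<gamma>" "l powr \<gamma> \<le> 1"
      using l \<gamma> by (auto simp del: powr_numeral intro!: powr_mono' powr_le1)
    then have p: "0 \<le> 1 - l powr \<gamma>" "1 - l powr \<gamma> \<le> 1 - l\<^sup>2"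
      using l by auto
    have "t * norm_pow x \<gamma> - t * norm_pow (l *\<^sub>R x) \<gamma> = (1 - l powr \<gamma>) * (t * norm_pow x \<gamma>)"
      using l by (simp add: norm_pow_scaleR algebra_simps)
    also have "\<dots> \<le> (1 - l powr \<gamma>) * (\<bar>t\<bar> * norm_pow x \<gamma>)"
      using p norm_pow_nonneg[of x \<gamma>] by (intro mult_left_mono mult_right_mono) auto
    also have "\<dots> \<le> (1 - l\<^sup>2) * (\<delta> * (norm x)\<^sup>2 + K)"
      using p K(2)[of x] norm_pow_nonneg[of x \<gamma>] by (intro mult_mono) auto
    finally have "exp (t * norm_pow x \<gamma>) \<le>
        exp (t * norm_pow (l *\<^sub>R x) \<gamma>) * exp ((1 - l\<^sup>2) * (\<delta> * (norm x)\<^sup>2 + K))"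
      unfolding exp_add[symmetric] exp_le_cancel_iff by linarith
    then show ?thesis
      using C by simp
  qed
  with K(1) show "\<exists>K\<ge>0. \<forall>l x. 0 < l \<longrightarrow> l < 1 \<longrightarrow> C * exp (t * norm_pow (x :: 'a) \<gamma>) \<le>
      C * exp (t * norm_pow (l *\<^sub>R x) \<gamma>) * exp ((1 - l\<^sup>2) * (\<delta> * (norm x)\<^sup>2 + K))"
    by blast
qed

lemma exp_norm_pow_in_P_D0:
  fixes C \<gamma> t :: real
  assumes C: "C > 0" and \<gamma>: "0 \<le> \<gamma>" "\<gamma> < 2"
  shows "(\<lambda>x :: 'a::euclidean_space. C * exp (t * norm_pow x \<gamma>)) \<in> P_D0"
proof -
  have Q0: "(\<lambda>x :: 'a. C * exp (t * norm_pow x \<gamma>)) \<in> P_Q0" if "C > 0" for C t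
    using exp_norm_pow_in_P_G0[OF that \<gamma>] P_G0_subset_P_Q0 by blast
  have nds: "narrowly_dilated_suitable \<epsilon> {0} (\<lambda>x :: 'a. C * exp (t * norm_pow x \<gamma>))"
    if "C > 0" "\<epsilon> > 0" for C t \<epsilon>
  proof (rule radially_tame_imp_narrowly_dilated_suitable[OF Q0])
    show "equivalent_weights (\<lambda>x :: 'a. C * exp (t * norm_pow x \<gamma>)) (\<lambda>x. C * exp (t * norm_pow x \<gamma>))"
      unfolding equivalent_weights_def by (intro exI[of _ 1]) simp
  qed (use that \<gamma> exp_norm_pow_weight exp_norm_pow_radially_tame in auto)
  have "(\<lambda>x :: 'a. 1 / (C * exp (t * norm_pow x \<gamma>))) = (\<lambda>x. (1 / C) * exp ((- t) * norm_pow x \<gamma>))"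
    by (simp add: exp_minus field_simps)
  then show ?thesis
    unfolding P_D0_def P_DV0_def using Q0[OF C] nds[OF C] nds[of "1 / C" _ "- t"] C by simp
qed

section \<open>The inclusions\<close>

theorem proposition3p4:
  fixes V :: "(real ^ 'n) set"
  assumes "subspace V"
  shows "((P_poly :: (real ^ 'n \<Rightarrow> real) set) \<subseteq> P_E \<and>
          (P_E :: (real ^ 'n \<Rightarrow> real) set) \<subseteq> P_D0 \<inter> P_G0) \<and>
         (P_D0 \<subseteq> P_DV0 V \<and> P_DV0 V \<subseteq> P_D) \<and>
         ((P_G0 :: (real ^ 'n \<Rightarrow> real) set) \<subseteq> P_Q0 \<inter> P_G \<and>
          (P_Q0 :: (real ^ 'n \<Rightarrow> real) set) \<inter> P_G \<subseteq> P_Q0 \<union> P_G \<and>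
          (P_Q0 :: (real ^ 'n \<Rightarrow> real) set) \<union> P_G \<subseteq> P_Q) \<and>
         (\<forall>C \<gamma> t. C > 0 \<longrightarrow> 0 \<le> \<gamma> \<longrightarrow> \<gamma> < 2 \<longrightarrow>
            (\<lambda>x :: real ^ 'n. C * exp (t * norm_pow x \<gamma>)) \<in> P_D0 \<inter> P_G0)"
  using P_poly_subset_P_E P_E_subset_P_D0 P_E_subset_P_G0 P_D0_subset_P_DV0 P_DV0_subset_P_D
    P_G0_subset_P_Q0 P_G0_subset_P_G P_Q0_subset_P_Q P_G_subset_P_Q
    exp_norm_pow_in_P_D0 exp_norm_pow_in_P_G0
  by (intro conjI allI impI) blast+

end
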